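(* Let $(L,[\cdot,\cdot,\cdot],\alpha,\beta)$ be a $3$-Bihom-Lie algebra over a field $\mathbb{K}$. Then there is an abelian product structure on $L$ if and only if $L=L_+\oplus L_-$ (direct sum of vector spaces), where $L_+$ and $L_-$ are abelian Bihom subalgebras of $L$.
   Context: A $3$-Bihom-Lie algebra over a field $\mathbb{K}$ is a $4$-tuple $(L,[\cdot,\cdot,\cdot],\alpha,\beta)$ consisting of a $\mathbb{K}$-vector space $L$, a $3$-linear map $[\cdot,\cdot,\cdot]\colon L\times L\times L\to L$ and two linear maps $\alpha,\beta\colon L\to L$ such that for all $x,y,z,u,v\in L$: (1) $\alpha\beta=\beta\alpha$; (2) $\alpha([x,y,z])=[\alpha(x),\alpha(y),\alpha(z)]$ and $\beta([x,y,z])=[\beta(x),\beta(y),\beta(z)]$; (3) $[\beta(x),\beta(y),\alpha(z)]=-[\beta(y),\beta(x),\alpha(z)]=-[\beta(x),\beta(z),\alpha(y)]$; (4) $[\beta^2(u),\beta^2(v),[\beta(x),\beta(y),\alpha(z)]]=[\beta^2(y),\beta^2(z),[\beta(u),\beta(v),\alpha(x)]]-[\beta^2(x),\beta^2(z),[\beta(u),\beta(v),\alpha(y)]]+[\beta^2(x),\beta^2(y),[\beta(u),\beta(v),\alpha(z)]]$. A linear subspace $\eta\subseteq L$ is a Bihom subalgebra if $\alpha(\eta)\subseteq\eta$, $\beta(\eta)\subseteq\eta$ and $[x,y,z]\in\eta$ for all $x,y,z\in\eta$. A Bihom subalgebra $\eta$ is abelian if $[x,y,z]=0$ for all $x,y,z\in\eta$.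 An almost product structure on $L$ is a linear map $E\colon L\to L$ with $E^2=\mathrm{Id}$, $E\neq\pm\mathrm{Id}$, $\alpha E=E\alpha$ and $\beta E=E\beta$. An almost product structure $E$ is called an abelian product structure if $[x,y,z]=-[x,Ey,Ez]-[Ex,y,Ez]-[Ex,Ey,z]$ for all $x,y,z\in L$.
   Formalization: The field is assumed to have characteristic different from 2, and both L_+ and L_- are required to be nonzero; without either condition the equivalence fails (e.g. L=K with zero bracket, or K^2 in characteristic 2 with α=diag(0,1), β=Id). *)

theory Defs
  imports Complex_Main
begin

definition trilinear :: "('k::field \<Rightarrow> 'v::ab_group_add \<Rightarrow> 'v) \<Rightarrow> ('v \<Rightarrow> 'v \<Rightarrow> 'v \<Rightarrow> 'v) \<Rightarrow> bool"
  where "trilinear scale f \<longleftrightarrow>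
    (\<forall>y z. Vector_Spaces.linear scale scale (\<lambda>x. f x y z)) \<and>
    (\<forall>x z. Vector_Spaces.linear scale scale (\<lambda>y. f x y z)) \<and>
    (\<forall>x y. Vector_Spaces.linear scale scale (\<lambda>z. f x y z))"

locale three_bihom_lie_algebra = vector_space scale
  for scale :: "'k::field \<Rightarrow> 'v::ab_group_add \<Rightarrow> 'v" +
  fixes br :: "'v \<Rightarrow> 'v \<Rightarrow> 'v \<Rightarrow> 'v"
    and \<alpha> \<beta> :: "'v \<Rightarrow> 'v"
  assumes br_trilinear: "trilinear scale br"
    and alpha_linear: "Vector_Spaces.linear scale scale \<alpha>"
    and beta_linear: "Vector_Spaces.linear scale scale \<beta>"
    and alpha_beta_commute: "\<alpha> \<circ> \<beta> = \<beta> \<circ> \<alpha>"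
    and alpha_br: "\<alpha> (br x y z) = br (\<alpha> x) (\<alpha> y) (\<alpha> z)"
    and beta_br: "\<beta> (br x y z) = br (\<beta> x) (\<beta> y) (\<beta> z)"
    and skew_12: "br (\<beta> x) (\<beta> y) (\<alpha> z) = - br (\<beta> y) (\<beta> x) (\<alpha> z)"
    and skew_23: "br (\<beta> x) (\<beta> y) (\<alpha> z) = - br (\<beta> x) (\<beta> z) (\<alpha> y)"
    and bihom_jacobi:
      "br (\<beta> (\<beta> u)) (\<beta> (\<beta> v)) (br (\<beta> x) (\<beta> y) (\<alpha> z)) =
         br (\<beta> (\<beta> y)) (\<beta> (\<beta> z)) (br (\<beta> u) (\<beta> v) (\<alpha> x))
       - br (\<beta> (\<beta> x)) (\<beta> (\<beta> z)) (br (\<beta> u) (\<beta> v) (\<alpha> y))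
       + br (\<beta> (\<beta> x)) (\<beta> (\<beta> y)) (br (\<beta> u) (\<beta> v) (\<alpha> z))"
begin

definition bihom_subalgebra :: "'v set \<Rightarrow> bool"
  where "bihom_subalgebra S \<longleftrightarrow>
    subspace S \<and> \<alpha> ` S \<subseteq> S \<and> \<beta> ` S \<subseteq> S \<and>
    (\<forall>x\<in>S. \<forall>y\<in>S. \<forall>z\<in>S. br x y z \<in> S)"

definition abelian_bihom_subalgebra :: "'v set \<Rightarrow> bool"
  where "abelian_bihom_subalgebra S \<longleftrightarrow>
    bihom_subalgebra S \<and> (\<forall>x\<in>S. \<forall>y\<in>S. \<forall>z\<in>S. br x y z = 0)"

definition almost_product_structure :: "('v \<Rightarrow> 'v) \<Rightarrow> bool"
  where "almost_product_structure E \<longleftrightarrow>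
    Vector_Spaces.linear scale scale E \<and> E \<circ> E = id \<and> E \<noteq> id \<and> E \<noteq> uminus \<and>
    \<alpha> \<circ> E = E \<circ> \<alpha> \<and> \<beta> \<circ> E = E \<circ> \<beta>"

definition abelian_product_structure :: "('v \<Rightarrow> 'v) \<Rightarrow> bool"
  where "abelian_product_structure E \<longleftrightarrow>
    almost_product_structure E \<and>
    (\<forall>x y z. br x y z = - br x (E y) (E z) - br (E x) y (E z) - br (E x) (E y) z)"

end

text \<open>The whole space, here the whole type, is the internal direct sum of the subspaces
  \<open>U\<close> and \<open>V\<close>. Summands are allowed to be zero.\<close>

definition direct_sum_decomposition ::
    "('k::field \<Rightarrow> 'v::ab_group_add \<Rightarrow> 'v) \<Rightarrow> 'v set \<Rightarrow> 'v set \<Rightarrow> bool"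
  where "direct_sum_decomposition scale U V \<longleftrightarrow>
    module.subspace scale U \<and> module.subspace scale V \<and>
    {u + v |u v. u \<in> U \<and> v \<in> V} = UNIV \<and> U \<inter> V = {0}"

end

theory Submission
  imports Defs
begin

text \<open>
  An abelian product structure \<open>E\<close> yields its eigenspaces for \<open>1\<close> and \<open>-1\<close>: on either of them the
  defining identity reads \<open>[x,y,z] = -3[x,y,z]\<close>, so the bracket vanishes when \<open>2\<close> is invertible.
  Conversely let \<open>E\<close> be the identity on \<open>L\<^sub>+\<close> and minus the identity on \<open>L\<^sub>-\<close>. By trilinearity the
  identity need only be tested on homogeneous arguments; it is automatic for mixed signs, and
  for equal signs it says that the bracket is zero.
\<close>

section \<open>Involutions, direct sums and projections in a vector space\<close>

context vector_space
begin

text \<open>Since \<open>x + x\<close> is \<open>2 *s x\<close>, an invertible \<open>2\<close> can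
  be cancelled. In particular a vector equal to its own negative is zero, which keeps the
  eigenvalues 1 and -1 apart.\<close>

lemma double_eq_0D:
  fixes x :: 'b
  assumes "(2::'a) \<noteq> 0" and "x + x = 0"
  shows "x = 0"
proof -
  have "2 *s x = x + x"
    using scale_left_distrib[of 1 1 x] by simp
  then show ?thesis
    using assms scale_eq_0_iff by simp
qed

lemma subspace_eigenspace:
  assumes "Vector_Spaces.linear scale scale E"
  shows "subspace {x. E x = c *s x}"
proof -
  interpret E: Vector_Spaces.linear scale scale E by fact
  show ?thesis
    by (rule subspaceI)
      (simp_all add: E.add E.scale E.zero scale_right_distrib scale_left_commute)
qed

text \<open>As \<open>E\<close> swaps \<open>x\<close> and \<open>E x\<close>, it fixes half their
  sum and negates half their difference; these two halves add up to \<open>x\<close>. A vector in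
  both eigenspaces is its own negative, hence zero.\<close>

lemma direct_sum_decomposition_involution:
  assumes E: "Vector_Spaces.linear scale scale E" "E \<circ> E = id"
    and two: "(2::'a) \<noteq> 0"
  shows "direct_sum_decomposition scale {x. E x = x} {x. E x = - x}"
proof -
  interpret E: Vector_Spaces.linear scale scale E by fact
  have EE: "E (E x) = x" for x
    using E(2) by (metis comp_apply id_apply)
  have "subspace {x. E x = x}" "subspace {x. E x = - x}"
    using subspace_eigenspace[OF E(1), of 1] subspace_eigenspace[OF E(1), of "- 1"] by simp_all
  moreover have "\<exists>u v. x = u + v \<and> E u = u \<and> E v = - v" for x
  proof (intro exI conjI)
    show "x = (1/2) *s (x + E x) + (1/2) *s (x - E x)"
    proof -
      \<comment> \<open>This holds for every scalar \<open>h\<close>; the value \<open>1/2\<close>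
        is singled out by \<open>h + h = 1\<close>.\<close>
      have "h *s (x + E x) + h *s (x - E x) = (h + h) *s x" for h
        unfolding scale_right_distrib scale_right_diff_distrib scale_left_distrib by simp
      moreover have "(1/2 + 1/2 :: 'a) = 1"
        using two by (metis add_divide_distrib divide_self one_add_one)
      ultimately show ?thesis by (metis scale_one)
    qed
  qed (simp_all add: E.add E.diff E.scale EE add.commute flip: scale_minus_right)
  moreover have "x = 0" if "E x = x" "E x = - x" for x
    using double_eq_0D[OF two, of x] that by (metis add.right_inverse)
  ultimately show ?thesis
    unfolding direct_sum_decomposition_def by (auto simp: E.zero)
qed

text \<open>Here \<open>p\<close> is the projection onto \<open>U\<close> along \<open>V\<close>. It
  is first chosen pointwise; the trivial intersection makes the choice unique, and uniqueness forces
  linearity.\<close>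

lemma direct_sum_decompositionE:
  assumes "direct_sum_decomposition scale U V"
  obtains p where "Vector_Spaces.linear scale scale p"
    and "\<And>x. p x \<in> U" and "\<And>x. x - p x \<in> V"
    and "\<And>u v. u \<in> U \<Longrightarrow> v \<in> V \<Longrightarrow> p (u + v) = u"
proof -
  have U: "subspace U" and V: "subspace V" and UV: "U \<inter> V = {0}"
    and sum: "{u + v |u v. u \<in> U \<and> v \<in> V} = UNIV"
    using assms unfolding direct_sum_decomposition_def by auto
  have "\<exists>u. u \<in> U \<and> x - u \<in> V" for x
  proof -
    have "x \<in> {u + v |u v. u \<in> U \<and> v \<in> V}"
      using sum by simp
    then show ?thesis
      by (auto intro: exI)
  qed
  then obtain p where pU: "\<And>x. p x \<in> U" and pV: "\<And>x. x - p x \<in> V"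
    by metis
  have p_eq: "p (u + v) = u" if "u \<in> U" "v \<in> V" for u v
  proof -
    have "p (u + v) - u \<in> U"
      using U pU that(1) by (rule subspace_diff)
    \<comment> \<open>This is the same vector \<open>p (u + v) - u\<close>, now written as a
      difference of \<open>V\<close>-components.\<close>
    moreover have "v - (u + v - p (u + v)) \<in> V"
      using V that(2) pV by (rule subspace_diff)
    ultimately have "p (u + v) - u \<in> U \<inter> V"
      by (simp add: algebra_simps)
    then show ?thesis
      using UV by simp
  qed
  \<comment> \<open>Adding the decompositions of \<open>x\<close> and \<open>y\<close> decomposes
    \<open>x + y\<close>, so uniqueness gives its \<open>U\<close>-component; scalar multiples work
    alike.\<close>
  have "p (x + y) = p x + p y" for x y
    using p_eq[OF subspace_add[OF U pU pU] subspace_add[OF V pV pV], of x y x y]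
    by (simp add: algebra_simps)
  moreover have "p (c *s x) = c *s p x" for c x
    using p_eq[OF subspace_scale[OF U pU] subspace_scale[OF V pV], of c x c x]
    by (simp add: algebra_simps)
  ultimately have "Vector_Spaces.linear scale scale p"
    by unfold_locales (simp_all add: algebra_simps)
  then show thesis
    using pU pV p_eq that by blast
qed

end

section \<open>Abelian product structures and abelian decompositions of a 3-Bihom-Lie
  algebra\<close>

context three_bihom_lie_algebra
begin

sublocale alpha: Vector_Spaces.linear scale scale \<alpha>
  by (rule alpha_linear)

sublocale beta: Vector_Spaces.linear scale scale \<beta>
  by (rule beta_linear)

lemma br_linear:
  "Vector_Spaces.linear scale scale (\<lambda>x. br x y z)"
  "Vector_Spaces.linear scale scale (\<lambda>y. br x y z)"
  "Vector_Spaces.linear scale scale (\<lambda>z. br x y z)"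
  using br_trilinear unfolding trilinear_def by auto

lemmas linear_imp_module_hom = linear_iff_module_hom[THEN iffD1]

lemmas br_add =
  br_linear(1)[THEN linear_imp_module_hom, THEN module_hom.add]
  br_linear(2)[THEN linear_imp_module_hom, THEN module_hom.add]
  br_linear(3)[THEN linear_imp_module_hom, THEN module_hom.add]

lemmas br_diff =
  br_linear(1)[THEN linear_imp_module_hom, THEN module_hom.diff]
  br_linear(2)[THEN linear_imp_module_hom, THEN module_hom.diff]
  br_linear(3)[THEN linear_imp_module_hom, THEN module_hom.diff]

lemmas br_minus =
  br_linear(1)[THEN linear_imp_module_hom, THEN module_hom.neg]
  br_linear(2)[THEN linear_imp_module_hom, THEN module_hom.neg]
  br_linear(3)[THEN linear_imp_module_hom, THEN module_hom.neg]

text \<open>Both signs are handled at once: each term on the right of the defining identity contains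
  \<open>E\<close> twice, which contributes \<open>c * c = 1\<close>. Closure under
  \<open>\<alpha>\<close> and \<open>\<beta>\<close> comes from their commuting with
  \<open>E\<close>; closure under the bracket is clear once it vanishes.\<close>

lemma abelian_bihom_subalgebra_eigenspace:
  assumes E: "abelian_product_structure E" and two: "(2::'k) \<noteq> 0"
    and c: "c = 1 \<or> c = - 1"
  shows "abelian_bihom_subalgebra {x. E x = scale c x}"
proof -
  have lin: "Vector_Spaces.linear scale scale E"
    and comm: "\<alpha> \<circ> E = E \<circ> \<alpha>" "\<beta> \<circ> E = E \<circ> \<beta>"
    and id: "\<And>x y z. br x y z = - br x (E y) (E z) - br (E x) y (E z) - br (E x) (E y) z"
    using E unfolding abelian_product_structure_def almost_product_structure_def by blast+
  interpret E: Vector_Spaces.linear scale scale E by fact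
  have zero: "br x y z = 0" if "E x = scale c x" "E y = scale c y" "E z = scale c z" for x y z
  proof -
    have "br x y z = - br x y z - br x y z - br x y z"
      by (subst id) (use c in \<open>auto simp: that br_minus\<close>)
    \<comment> \<open>The four copies are paired so that cancelling \<open>2\<close> twice
      finishes.\<close>
    then have "(br x y z + br x y z) + (br x y z + br x y z) = 0"
      by (simp add: algebra_simps)
    then show ?thesis
      using double_eq_0D[OF two] by blast
  qed
  have "E (\<alpha> x) = \<alpha> (E x)" "E (\<beta> x) = \<beta> (E x)" for x
    using comm by (metis comp_apply)+
  then show ?thesis
    unfolding abelian_bihom_subalgebra_def bihom_subalgebra_def
    using subspace_eigenspace[OF lin, of c]
    by (auto simp: zero E.zero alpha.scale beta.scale)
qed

lemma abelian_product_structureE: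
  assumes E: "abelian_product_structure E" and two: "(2::'k) \<noteq> 0"
  obtains U V where "direct_sum_decomposition scale U V" "U \<noteq> {0}" "V \<noteq> {0}"
    "abelian_bihom_subalgebra U" "abelian_bihom_subalgebra V"
proof -
  have lin: "Vector_Spaces.linear scale scale E" and inv: "E \<circ> E = id"
    and nontriv: "E \<noteq> id" "E \<noteq> uminus"
    using E unfolding abelian_product_structure_def almost_product_structure_def by blast+
  interpret E: Vector_Spaces.linear scale scale E by fact
  have EE: "E (E x) = x" for x
    using inv by (metis comp_apply id_apply)
  \<comment> \<open>Every \<open>x + E x\<close> is fixed by \<open>E\<close>, so
    \<open>E \<noteq> uminus\<close> supplies a nonzero fixed vector.\<close>
  have "\<exists>x. x + E x \<noteq> 0"
    using nontriv(2) by (metis add.commute eq_neg_iff_add_eq_0 ext)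
  then have "{x. E x = x} \<noteq> {0}"
    by (metis (mono_tags, lifting) E.add EE add.commute mem_Collect_eq singletonD)
  \<comment> \<open>Dually, \<open>E\<close> negates every \<open>x - E x\<close>, and
    \<open>E \<noteq> id\<close> makes one of them nonzero.\<close>
  moreover have "\<exists>x. x - E x \<noteq> 0"
    using nontriv(1) by (metis eq_iff_diff_eq_0 ext id_apply)
  then have "{x. E x = - x} \<noteq> {0}"
    by (metis (mono_tags, lifting) E.diff EE mem_Collect_eq minus_diff_eq singletonD)
  moreover have "abelian_bihom_subalgebra {x. E x = x}"
    "abelian_bihom_subalgebra {x. E x = - x}"
    using abelian_bihom_subalgebra_eigenspace[OF E two, of 1]
      abelian_bihom_subalgebra_eigenspace[OF E two, of "- 1"] by simp_all
  ultimately show thesis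
    using that direct_sum_decomposition_involution[OF lin inv two] by blast
qed

lemma abelian_product_structure_direct_sum:
  assumes dec: "direct_sum_decomposition scale U V" and "U \<noteq> {0}" "V \<noteq> {0}"
    and U: "abelian_bihom_subalgebra U" and V: "abelian_bihom_subalgebra V"
    and two: "(2::'k) \<noteq> 0"
  shows "\<exists>E. abelian_product_structure E"
proof -
  obtain p where lin: "Vector_Spaces.linear scale scale p"
    and pU: "\<And>x. p x \<in> U" and pV: "\<And>x. x - p x \<in> V"
    and p_eq: "\<And>u v. u \<in> U \<Longrightarrow> v \<in> V \<Longrightarrow> p (u + v) = u"
    using direct_sum_decompositionE[OF dec] by blast
  interpret p: Vector_Spaces.linear scale scale p by fact
  \<comment> \<open>The reflection that fixes \<open>U\<close> pointwise and negates
    \<open>V\<close>.\<close>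
  define E where "E x = p x - (x - p x)" for x
  have subU: "subspace U" and subV: "subspace V"
    using U V unfolding abelian_bihom_subalgebra_def bihom_subalgebra_def by auto
  have pU_id: "p u = u" if "u \<in> U" for u
    using p_eq[OF that subspace_0[OF subV]] by simp
  have pV_0: "p v = 0" if "v \<in> V" for v
    using p_eq[OF subspace_0[OF subU] that] by simp
  \<comment> \<open>Applying \<open>f\<close> to the two components of \<open>x\<close> yields the
    components of \<open>f x\<close>, because \<open>f\<close> preserves both summands.\<close>
  have p_commute: "p (f x) = f (p x)"
    if f: "Vector_Spaces.linear scale scale f" "f ` U \<subseteq> U" "f ` V \<subseteq> V" for f x
  proof -
    interpret f: Vector_Spaces.linear scale scale f by fact
    have "p (f (p x) + f (x - p x)) = f (p x)"
      using f(2,3) pU pV by (intro p_eq) auto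
    then show ?thesis
      by (simp flip: f.add)
  qed
  have p_alpha: "p (\<alpha> x) = \<alpha> (p x)" and p_beta: "p (\<beta> x) = \<beta> (p x)" for x
    using U V unfolding abelian_bihom_subalgebra_def bihom_subalgebra_def
    by (auto intro!: p_commute alpha_linear beta_linear)
  have linE: "Vector_Spaces.linear scale scale E"
    by unfold_locales (simp_all add: E_def p.add p.scale algebra_simps)
  have "E \<circ> E = id"
    by (rule ext) (simp add: E_def p.diff pU_id[OF pU])
  moreover have "E \<noteq> id"
  proof -
    obtain v where v: "v \<in> V" "v \<noteq> 0"
      using \<open>V \<noteq> {0}\<close> subspace_0[OF subV] by blast
    then have "E v = - v"
      by (simp add: E_def pV_0)
    then have "E v \<noteq> v"
      using double_eq_0D[OF two, of v] v(2) by (metis add.right_inverse)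
    then show ?thesis by auto
  qed
  moreover have "E \<noteq> uminus"
  proof -
    obtain u where u: "u \<in> U" "u \<noteq> 0"
      using \<open>U \<noteq> {0}\<close> subspace_0[OF subU] by blast
    then have "E u = u"
      by (simp add: E_def pU_id)
    then have "E u \<noteq> - u"
      using double_eq_0D[OF two, of u] u(2) by (metis add.right_inverse)
    then show ?thesis by auto
  qed
  moreover have "\<alpha> \<circ> E = E \<circ> \<alpha>" "\<beta> \<circ> E = E \<circ> \<beta>"
    by (auto simp: E_def p_alpha p_beta alpha.diff beta.diff)
  moreover have "br x y z = - br x (E y) (E z) - br (E x) y (E z) - br (E x) (E y) z" for x y z
  proof -
    define a where "a x = x - p x" for x
    have split: "x = p x + a x" and E_split: "E x = p x - a x" for x
      by (simp_all add: a_def E_def)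
    have [simp]: "br (p x) (p y) (p z) = 0" "br (a x) (a y) (a z) = 0"
      using U V pU pV unfolding abelian_bihom_subalgebra_def a_def by blast+
    \<comment> \<open>Expand into eight brackets of components. If the slots carry signs r, s, t,
      the right side has coefficient -(rs + rt + st). For mixed signs this is 1, as on the left; for
      equal signs the bracket is zero.\<close>
    have "br (p x + a x) (p y + a y) (p z + a z) =
        - br (p x + a x) (p y - a y) (p z - a z) - br (p x - a x) (p y + a y) (p z - a z)
        - br (p x - a x) (p y - a y) (p z + a z)"
      by (simp add: br_add br_diff)
    then show ?thesis
      by (simp only: E_split flip: split)
  qed
  ultimately show ?thesis
    using linE unfolding abelian_product_structure_def almost_product_structure_def by blast
qed

end

text \<open>Nonzero summands match \<open>E\<close> being neither \<open>id\<close> nor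
  \<open>uminus\<close>: for an involution, one of its eigenspaces is zero exactly in those cases.
  In characteristic 2 the eigenvalues 1 and -1 coincide, so the eigenspaces would not split the
  space.\<close>

theorem corollary3p9:
  fixes scale :: "'k::field \<Rightarrow> 'v::ab_group_add \<Rightarrow> 'v"
    and br :: "'v \<Rightarrow> 'v \<Rightarrow> 'v \<Rightarrow> 'v"
    and \<alpha> \<beta> :: "'v \<Rightarrow> 'v"
  assumes "three_bihom_lie_algebra scale br \<alpha> \<beta>"
    and "(2::'k) \<noteq> 0"
  shows "(\<exists>E. three_bihom_lie_algebra.abelian_product_structure scale br \<alpha> \<beta> E) \<longleftrightarrow>
    (\<exists>Lp Lm. direct_sum_decomposition scale Lp Lm \<and> Lp \<noteq> {0} \<and> Lm \<noteq> {0} \<and>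
       three_bihom_lie_algebra.abelian_bihom_subalgebra scale br \<alpha> \<beta> Lp \<and>
       three_bihom_lie_algebra.abelian_bihom_subalgebra scale br \<alpha> \<beta> Lm)"
proof -
  interpret three_bihom_lie_algebra scale br \<alpha> \<beta> by fact
  show ?thesis
  proof
    assume "\<exists>E. abelian_product_structure E"
    then show "\<exists>Lp Lm. direct_sum_decomposition scale Lp Lm \<and> Lp \<noteq> {0} \<and> Lm \<noteq> {0} \<and>
        abelian_bihom_subalgebra Lp \<and> abelian_bihom_subalgebra Lm"
      by (elim exE) (rule abelian_product_structureE[OF _ assms(2)], blast+)
  next
    assume "\<exists>Lp Lm. direct_sum_decomposition scale Lp Lm \<and> Lp \<noteq> {0} \<and> Lm \<noteq> {0} \<and>
        abelian_bihom_subalgebra Lp \<and> abelian_bihom_subalgebra Lm"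
    then show "\<exists>E. abelian_product_structure E"
      by (elim exE conjE) (rule abelian_product_structure_direct_sum[OF _ _ _ _ _ assms(2)])
  qed
qed

end
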